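(* Let $\mathcal{L}:J^1(\mathbb{R},Q)=\mathbb{R}\times TQ\to\mathbb{R}$ be a hyperregular Lagrangian of class $C^2$ and $\gamma:Q\to\mathbb{R}$ of class $C^2$. Then the stochastic generalized fractional Hamilton-Pontryagin equations $$dq^i=v^i\,ds,\qquad dp_i=\Big[\frac{\partial\mathcal{L}}{\partial q^i}-p_i\,h(s,t)\Big]ds+\frac{\partial\gamma(q)}{\partial q^i}\,dw(s),\qquad p_i=\frac{\partial\mathcal{L}}{\partial v^i},\quad i=1,\dots,n,\ t\ne s,$$ are equivalent to the stochastic generalized fractional Hamilton equations $$dq^i=\frac{\partial H}{\partial p_i}\,ds,\qquad dp_i=\Big(-\frac{\partial H}{\partial q^i}-p_i\,h(s,t)\Big)ds+\frac{\partial\gamma(q)}{\partial q^i}\,dw(s),$$ where $$H=p_iv^i-\mathcal{L}(s,q,v),$$ $$h(s,t)=\frac{d\alpha(s-t)}{ds}\ln|t-s|+\frac{\alpha(s-t)-1}{s-t}+\rho-\frac{1}{\Gamma_1(\alpha(s-t))}\frac{d\Gamma_1(\alpha(s-t))}{ds}.$$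
   Context: $Q$ is a paracompact $n$-dimensional manifold with local coordinates $q^i$; $v^i$, $p_i$ are the induced fibre coordinates on $TQ$, $T^*Q$; repeated indices are summed. Hyperregular means that $\det\big(\partial^2\mathcal{L}/\partial v^i\partial v^j\big)\neq 0$. In $H$, $v$ and $p$ are related by $p_i=\partial\mathcal{L}/\partial v^i$. $\alpha:\mathbb{R}\to\mathbb{R}$ is of class $C^1$, $\rho$ is a real constant, $s$ is the intrinsic time and $t$ the observer time. $\Gamma_1(\alpha(s-t))=\Gamma(\alpha(z))|_{z=s-t}$, where $\Gamma(x)=\int_0^\infty u^{x-1}e^{-u}\,du$ is the Euler Gamma function. $w$ is a real-valued Wiener process on a probability space; equations involving $dw(s)$ are Itô stochastic differential equations. *)

theory Defs
  imports "HOL-Probability.Probability"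
begin

section \<open>Calculus\<close>

primrec Ck_on :: "nat \<Rightarrow> 'a::euclidean_space set \<Rightarrow> ('a \<Rightarrow> 'b::real_normed_vector) \<Rightarrow> bool" where
  "Ck_on 0 S f \<longleftrightarrow> continuous_on S f"
| "Ck_on (Suc k) S f \<longleftrightarrow> f differentiable_on S \<and>
     (\<forall>b\<in>Basis. Ck_on k S (\<lambda>x. frechet_derivative f (at x) b))"

text \<open>\<^term>\<open>Ck_on k S f\<close> is only meant for open \<^term>\<open>S\<close>.\<close>

definition pd :: "(real^'n \<Rightarrow> real) \<Rightarrow> real^'n \<Rightarrow> 'n::finite \<Rightarrow> real" where
  "pd f x i = deriv (\<lambda>e. f (x + e *\<^sub>R axis i 1)) 0"

section \<open>Manifolds, tangent and cotangent vectors\<close>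

definition paracompact_space :: "'q topology \<Rightarrow> bool" where
  "paracompact_space X \<longleftrightarrow>
     (\<forall>\<U>. (\<forall>U\<in>\<U>. openin X U) \<and> \<Union>\<U> = topspace X \<longrightarrow>
       (\<exists>\<V>. (\<forall>V\<in>\<V>. openin X V) \<and> \<Union>\<V> = topspace X \<and>
            (\<forall>V\<in>\<V>. \<exists>U\<in>\<U>. V \<subseteq> U) \<and> locally_finite_in X \<V>))"

type_synonym ('q, 'n) chart = "'q set \<times> ('q \<Rightarrow> real^'n)"

definition point :: "('q, 'n::finite) chart \<Rightarrow> real^'n \<Rightarrow> 'q" where
  "point c = inv_into (fst c) (snd c)"

definition transition :: "('q, 'n::finite) chart \<Rightarrow> ('q, 'n) chart \<Rightarrow> real^'n \<Rightarrow> real^'n" where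
  "transition c d = snd d \<circ> point c"

definition jacobian ::
  "('q, 'n::finite) chart \<Rightarrow> ('q, 'n) chart \<Rightarrow> 'q \<Rightarrow> real^'n \<Rightarrow> real^'n" where
  "jacobian c d x = frechet_derivative (transition c d) (at (snd c x))"

definition smooth_manifold :: "'q topology \<Rightarrow> ('q, 'n::finite) chart set \<Rightarrow> bool" where
  "smooth_manifold X A \<longleftrightarrow>
     Hausdorff_space X \<and> paracompact_space X \<and>
     (\<forall>c\<in>A. openin X (fst c) \<and> open (snd c ` fst c) \<and>
        homeomorphic_map (subtopology X (fst c)) (top_of_set (snd c ` fst c)) (snd c)) \<and>
     (\<Union>c\<in>A. fst c) = topspace X \<and>
     (\<forall>c\<in>A. \<forall>d\<in>A. \<forall>k. Ck_on k (snd c ` (fst c \<inter> fst d)) (transition c d))"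

text \<open>A tangent or cotangent vector is the family of its components in all charts of the atlas
  around its base point, subject to the usual transformation rule. In all other charts the
  components are set to 0, so that a vector is uniquely represented.\<close>

type_synonym ('q, 'n) components = "('q, 'n) chart \<Rightarrow> real^'n"

definition tangent_space ::
  "('q, 'n::finite) chart set \<Rightarrow> 'q \<Rightarrow> ('q, 'n) components set" where
  "tangent_space A x = {v.
     (\<forall>c. \<not> (c \<in> A \<and> x \<in> fst c) \<longrightarrow> v c = 0) \<and>
     (\<forall>c\<in>A. \<forall>d\<in>A. x \<in> fst c \<inter> fst d \<longrightarrow> v d = jacobian c d x (v c))}"

definition cotangent_space ::
  "('q, 'n::finite) chart set \<Rightarrow> 'q \<Rightarrow> ('q, 'n) components set" where
  "cotangent_space A x = {p.
     (\<forall>c. \<not> (c \<in> A \<and> x \<in> fst c) \<longrightarrow> p c = 0) \<and>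
     (\<forall>c\<in>A. \<forall>d\<in>A. x \<in> fst c \<inter> fst d \<longrightarrow>
        (\<forall>u. p c \<bullet> u = p d \<bullet> jacobian c d x u))}"

definition tangent_vector ::
  "('q, 'n::finite) chart set \<Rightarrow> ('q, 'n) chart \<Rightarrow> 'q \<Rightarrow> real^'n \<Rightarrow> ('q, 'n) components" where
  "tangent_vector A c x y = (\<lambda>d. if d \<in> A \<and> x \<in> fst d then jacobian c d x y else 0)"

section \<open>Lagrangians and Hamiltonians\<close>

text \<open>A Lagrangian on \<open>\<real> \<times> TQ\<close> takes a time, a base point and a tangent vector there.\<close>

type_synonym ('q, 'n) lagrangian = "real \<Rightarrow> 'q \<Rightarrow> ('q, 'n) components \<Rightarrow> real"

type_synonym 'n local_lagrangian = "real \<Rightarrow> real^'n \<Rightarrow> real^'n \<Rightarrow> real"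

definition local_lag ::
  "('q, 'n::finite) chart set \<Rightarrow> ('q, 'n) lagrangian \<Rightarrow> ('q, 'n) chart \<Rightarrow> 'n local_lagrangian" where
  "local_lag A L c s x y = L s (point c x) (tangent_vector A c (point c x) y)"

definition C2_lagrangian ::
  "('q, 'n::finite) chart set \<Rightarrow> ('q, 'n) lagrangian \<Rightarrow> bool" where
  "C2_lagrangian A L \<longleftrightarrow>
     (\<forall>c\<in>A. Ck_on 2 (UNIV \<times> snd c ` fst c \<times> UNIV) (\<lambda>(s, x, y). local_lag A L c s x y))"

definition C2_function :: "('q, 'n::finite) chart set \<Rightarrow> ('q \<Rightarrow> real) \<Rightarrow> bool" where
  "C2_function A \<gamma> \<longleftrightarrow> (\<forall>c\<in>A. Ck_on 2 (snd c ` fst c) (\<gamma> \<circ> point c))"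

definition hyperregular ::
  "('q, 'n::finite) chart set \<Rightarrow> ('q, 'n) lagrangian \<Rightarrow> bool" where
  "hyperregular A L \<longleftrightarrow>
     (\<forall>c\<in>A. \<forall>s. \<forall>x\<in>snd c ` fst c. \<forall>y.
        det (\<chi> i j. pd (\<lambda>z. pd (local_lag A L c s x) z j) y i) \<noteq> 0)"

definition legendre :: "'n::finite local_lagrangian \<Rightarrow> real \<Rightarrow> real^'n \<Rightarrow> real^'n \<Rightarrow> real^'n" where
  "legendre l s x y = (\<chi> i. pd (l s x) y i)"

text \<open>\<open>V\<close> expresses the velocity through \<open>(s, q, p)\<close> by solving \<open>p = \<partial>L/\<partial>v\<close>, near the
  point corresponding to \<open>(s0, x0, y0)\<close>; \<open>D\<close> is the coordinate domain.\<close>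

definition velocity_branch ::
  "'n::finite local_lagrangian \<Rightarrow> (real^'n) set \<Rightarrow> real \<Rightarrow> real^'n \<Rightarrow> real^'n \<Rightarrow>
   (real \<times> (real^'n) \<times> (real^'n) \<Rightarrow> real^'n) \<Rightarrow> bool" where
  "velocity_branch l D s0 x0 y0 V \<longleftrightarrow>
     (\<exists>W. open W \<and> (s0, x0, legendre l s0 x0 y0) \<in> W \<and> continuous_on W V \<and>
          V (s0, x0, legendre l s0 x0 y0) = y0 \<and>
          (\<forall>(s, x, p)\<in>W. x \<in> D \<and> legendre l s x (V (s, x, p)) = p))"

text \<open>The Hamiltonian \<open>H(s, x, p) = p\<^sub>i v\<^sup>i - L(s, x, v)\<close> with \<open>p = \<partial>L/\<partial>v\<close>. A nonzero Hessian
  determinant makes the Legendre map only locally invertible, so that \<open>H\<close> may have several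
  branches as a function of \<open>(s, x, p)\<close>; this is the one with \<open>v = y0\<close> at \<open>(s0, x0)\<close>. By the
  inverse function theorem a branch exists and its germ at that point is unique, and only this germ
  is used below. If the Legendre map is injective on the fibres, there is just one branch.\<close>

definition hamiltonian ::
  "'n::finite local_lagrangian \<Rightarrow> (real^'n) set \<Rightarrow> real \<Rightarrow> real^'n \<Rightarrow> real^'n \<Rightarrow>
   real \<Rightarrow> real^'n \<Rightarrow> real^'n \<Rightarrow> real" where
  "hamiltonian l D s0 x0 y0 s x p =
     (let v = (SOME V. velocity_branch l D s0 x0 y0 V) (s, x, p)
      in (\<Sum>i\<in>UNIV. p $ i * v $ i) - l s x v)"

section \<open>The Wiener process and the Ito integral\<close>

definition wiener_process ::
  "'w measure \<Rightarrow> (real \<Rightarrow> 'w measure) \<Rightarrow> (real \<Rightarrow> 'w \<Rightarrow> real) \<Rightarrow> bool" where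
  "wiener_process M F w \<longleftrightarrow>
     prob_space M \<and> filtration (space M) F \<and> (\<forall>s. sets (F s) \<subseteq> sets M) \<and>
     (\<forall>s\<ge>0. w s \<in> borel_measurable (F s)) \<and>
     (AE \<omega> in M. w 0 \<omega> = 0) \<and>
     (AE \<omega> in M. continuous_on {0..} (\<lambda>s. w s \<omega>)) \<and>
     (\<forall>r\<ge>0. \<forall>s>r.
        distributed M lborel (\<lambda>\<omega>. w s \<omega> - w r \<omega>)
          (\<lambda>x. ennreal (normal_density 0 (sqrt (s - r)) x)) \<and>
        prob_space.indep_set M (sets (F r))
          (sets (vimage_algebra (space M) (\<lambda>\<omega>. w s \<omega> - w r \<omega>) borel)))"

definition progressive ::
  "(real \<Rightarrow> 'w measure) \<Rightarrow> real \<Rightarrow> real \<Rightarrow> (real \<Rightarrow> 'w \<Rightarrow> real) \<Rightarrow> bool" where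
  "progressive F a b \<phi> \<longleftrightarrow>
     (\<forall>u\<in>{a..b}. (\<lambda>(s, \<omega>). \<phi> s \<omega>) \<in> borel_measurable (restrict_space borel {a..u} \<Otimes>\<^sub>M F u))"

text \<open>\<open>(K, r, \<xi>)\<close> encodes the elementary process with value \<open>\<xi>\<^sub>k\<close> on \<open>[r\<^sub>k, r\<^sub>k\<^sub>+\<^sub>1)\<close> for \<open>k < K\<close>.\<close>

type_synonym 'w elementary = "nat \<times> (nat \<Rightarrow> real) \<times> (nat \<Rightarrow> 'w \<Rightarrow> real)"

fun elementary :: "(real \<Rightarrow> 'w measure) \<Rightarrow> real \<Rightarrow> real \<Rightarrow> 'w elementary \<Rightarrow> bool" where
  "elementary F a b (K, r, \<xi>) \<longleftrightarrow>
     r 0 = a \<and> r K = b \<and>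
     (\<forall>k<K. r k \<le> r (Suc k) \<and> \<xi> k \<in> borel_measurable (F (r k)) \<and>
        (\<exists>B. \<forall>\<omega>\<in>space (F (r k)). \<bar>\<xi> k \<omega>\<bar> \<le> B))"

fun elementary_value :: "'w elementary \<Rightarrow> real \<Rightarrow> 'w \<Rightarrow> real" where
  "elementary_value (K, r, \<xi>) s \<omega> = (\<Sum>k<K. indicator {r k..<r (Suc k)} s * \<xi> k \<omega>)"

fun elementary_integral :: "(real \<Rightarrow> 'w \<Rightarrow> real) \<Rightarrow> 'w elementary \<Rightarrow> 'w \<Rightarrow> real" where
  "elementary_integral w (K, r, \<xi>) \<omega> = (\<Sum>k<K. \<xi> k \<omega> * (w (r (Suc k)) \<omega> - w (r k) \<omega>))"

definition null_in_prob :: "'w measure \<Rightarrow> (nat \<Rightarrow> 'w \<Rightarrow> ennreal) \<Rightarrow> bool" where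
  "null_in_prob M D \<longleftrightarrow>
     (\<forall>e>0. (\<lambda>j. measure M {\<omega> \<in> space M. D j \<omega> > ennreal e}) \<longlonglongrightarrow> 0)"

text \<open>\<open>I\<close> is (a version of) the Ito integral of \<open>\<phi>\<close> over \<open>[a, b]\<close>, for progressively measurable
  \<open>\<phi>\<close> with almost surely square integrable paths: the limit in probability of the integrals of
  elementary processes that approximate \<open>\<phi>\<close> in \<open>L\<^sup>2([a, b])\<close> in probability.\<close>

definition ito_integral ::
  "'w measure \<Rightarrow> (real \<Rightarrow> 'w measure) \<Rightarrow> (real \<Rightarrow> 'w \<Rightarrow> real) \<Rightarrow> real \<Rightarrow> real \<Rightarrow>
   (real \<Rightarrow> 'w \<Rightarrow> real) \<Rightarrow> ('w \<Rightarrow> real) \<Rightarrow> bool" where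
  "ito_integral M F w a b \<phi> I \<longleftrightarrow>
     progressive F a b \<phi> \<and>
     (AE \<omega> in M. (\<integral>\<^sup>+s\<in>{a..b}. ennreal ((\<phi> s \<omega>)\<^sup>2) \<partial>lborel) < \<infinity>) \<and>
     I \<in> borel_measurable M \<and>
     (\<exists>P. (\<forall>j. elementary F a b (P j)) \<and>
        null_in_prob M
          (\<lambda>j \<omega>. \<integral>\<^sup>+s\<in>{a..b}. ennreal ((elementary_value (P j) s \<omega> - \<phi> s \<omega>)\<^sup>2) \<partial>lborel) \<and>
        null_in_prob M (\<lambda>j \<omega>. ennreal \<bar>elementary_integral w (P j) \<omega> - I \<omega>\<bar>))"

text \<open>\<open>Z\<close> is almost surely equal to \<open>\<integral> \<mu> ds + \<integral> \<sigma> dw\<close> over \<open>[a, b]\<close>.\<close>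

definition ito_increment ::
  "'w measure \<Rightarrow> (real \<Rightarrow> 'w measure) \<Rightarrow> (real \<Rightarrow> 'w \<Rightarrow> real) \<Rightarrow> real \<Rightarrow> real \<Rightarrow>
   (real \<Rightarrow> 'w \<Rightarrow> real) \<Rightarrow> (real \<Rightarrow> 'w \<Rightarrow> real) \<Rightarrow> ('w \<Rightarrow> real) \<Rightarrow> bool" where
  "ito_increment M F w a b \<mu> \<sigma> Z \<longleftrightarrow>
     progressive F a b \<mu> \<and>
     (AE \<omega> in M. set_integrable lborel {a..b} (\<lambda>s. \<mu> s \<omega>)) \<and>
     (\<exists>I. ito_integral M F w a b \<sigma> I \<and>
        (AE \<omega> in M. Z \<omega> = (LINT s:{a..b}|lborel. \<mu> s \<omega>) + I \<omega>))"

section \<open>Stochastic differential equations in local coordinates\<close>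

text \<open>The system \<open>dY\<^sup>i = \<mu>\<^sup>i ds + \<sigma>\<^sup>i dw\<close> in every chart. Here \<open>Y c\<close>, \<open>\<mu> c\<close> and \<open>\<sigma> c\<close> are the
  coordinate expressions in the chart \<open>c\<close>. They make sense only as long as the base process
  \<open>q\<close> is in the chart domain, so the integrated equation is required between any two stopping
  times \<open>\<tau>1 \<le> \<tau>2\<close> between which \<open>q\<close> does not leave this domain.\<close>

definition coordinate_sde ::
  "('q, 'n::finite) chart set \<Rightarrow> 'w measure \<Rightarrow> (real \<Rightarrow> 'w measure) \<Rightarrow> (real \<Rightarrow> 'w \<Rightarrow> real) \<Rightarrow>
   real set \<Rightarrow> (real \<Rightarrow> 'w \<Rightarrow> 'q) \<Rightarrow>
   (('q, 'n) chart \<Rightarrow> real \<Rightarrow> 'w \<Rightarrow> real^'n) \<Rightarrow>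
   (('q, 'n) chart \<Rightarrow> real \<Rightarrow> 'w \<Rightarrow> real^'n) \<Rightarrow>
   (('q, 'n) chart \<Rightarrow> real \<Rightarrow> 'w \<Rightarrow> real^'n) \<Rightarrow> bool" where
  "coordinate_sde A M F w T q Y \<mu> \<sigma> \<longleftrightarrow>
     (\<forall>c\<in>A. \<forall>a\<in>T. \<forall>b\<in>T. \<forall>\<tau>1 \<tau>2.
        stopping_time F \<tau>1 \<and> stopping_time F \<tau>2 \<and>
        (\<forall>\<omega>\<in>space M. a \<le> \<tau>1 \<omega> \<and> \<tau>1 \<omega> \<le> \<tau>2 \<omega> \<and> \<tau>2 \<omega> \<le> b \<and>
           (\<tau>1 \<omega> < \<tau>2 \<omega> \<longrightarrow> (\<forall>s\<in>{\<tau>1 \<omega>..\<tau>2 \<omega>}. q s \<omega> \<in> fst c))) \<longrightarrow>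
        (\<forall>i. ito_increment M F w a b
           (\<lambda>s \<omega>. indicator {\<tau>1 \<omega>..<\<tau>2 \<omega>} s * \<mu> c s \<omega> $ i)
           (\<lambda>s \<omega>. indicator {\<tau>1 \<omega>..<\<tau>2 \<omega>} s * \<sigma> c s \<omega> $ i)
           (\<lambda>\<omega>. Y c (\<tau>2 \<omega>) \<omega> $ i - Y c (\<tau>1 \<omega>) \<omega> $ i)))"

text \<open>\<open>(q, v, p)\<close> is an adapted process in \<open>TQ \<oplus> T\<^sup>*Q\<close> over the time set \<open>T\<close>; \<open>(q, p)\<close> has
  continuous paths.\<close>

definition phase_process ::
  "'q topology \<Rightarrow> ('q, 'n::finite) chart set \<Rightarrow> 'w measure \<Rightarrow> (real \<Rightarrow> 'w measure) \<Rightarrow> real set \<Rightarrow>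
   (real \<Rightarrow> 'w \<Rightarrow> 'q) \<Rightarrow> (real \<Rightarrow> 'w \<Rightarrow> ('q, 'n) components) \<Rightarrow>
   (real \<Rightarrow> 'w \<Rightarrow> ('q, 'n) components) \<Rightarrow> bool" where
  "phase_process X A M F T q v p \<longleftrightarrow>
     (\<forall>s\<in>T. \<forall>\<omega>\<in>space M. q s \<omega> \<in> topspace X \<and>
        v s \<omega> \<in> tangent_space A (q s \<omega>) \<and> p s \<omega> \<in> cotangent_space A (q s \<omega>)) \<and>
     (\<forall>\<omega>\<in>space M. continuous_map (top_of_set T) X (\<lambda>s. q s \<omega>) \<and>
        (\<forall>c\<in>A. continuous_on {s\<in>T. q s \<omega> \<in> fst c} (\<lambda>s. p s \<omega> c))) \<and>
     (\<forall>s\<in>T. (\<forall>U. openin X U \<longrightarrow> {\<omega> \<in> space M. q s \<omega> \<in> U} \<in> sets (F s)) \<and>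
        (\<forall>c\<in>A. (\<lambda>\<omega>. v s \<omega> c) \<in> borel_measurable (F s) \<and>
               (\<lambda>\<omega>. p s \<omega> c) \<in> borel_measurable (F s)))"

definition legendre_related ::
  "('q, 'n::finite) chart set \<Rightarrow> 'w measure \<Rightarrow> ('q, 'n) lagrangian \<Rightarrow> real set \<Rightarrow>
   (real \<Rightarrow> 'w \<Rightarrow> 'q) \<Rightarrow> (real \<Rightarrow> 'w \<Rightarrow> ('q, 'n) components) \<Rightarrow>
   (real \<Rightarrow> 'w \<Rightarrow> ('q, 'n) components) \<Rightarrow> bool" where
  "legendre_related A M L T q v p \<longleftrightarrow>
     (\<forall>c\<in>A. \<forall>s\<in>T. \<forall>\<omega>\<in>space M. q s \<omega> \<in> fst c \<longrightarrow>
        (\<forall>i. p s \<omega> c $ i = pd (local_lag A L c s (snd c (q s \<omega>))) (v s \<omega> c) i))"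

text \<open>The integral defining the Gamma function converges for positive arguments only; there it agrees
  with \<^const>\<open>Gamma\<close>. No sign condition on \<open>\<alpha>\<close> is imposed.\<close>

definition Gamma1 :: "(real \<Rightarrow> real) \<Rightarrow> real \<Rightarrow> real" where
  "Gamma1 \<alpha> z = Gamma (\<alpha> z)"

definition h_frac :: "(real \<Rightarrow> real) \<Rightarrow> real \<Rightarrow> real \<Rightarrow> real \<Rightarrow> real" where
  "h_frac \<alpha> \<rho> s t =
     deriv (\<lambda>s. \<alpha> (s - t)) s * ln \<bar>t - s\<bar> + (\<alpha> (s - t) - 1) / (s - t) + \<rho>
     - 1 / Gamma1 \<alpha> (s - t) * deriv (\<lambda>s. Gamma1 \<alpha> (s - t)) s"

definition hamilton_pontryagin_eqs ::
  "'q topology \<Rightarrow> ('q, 'n::finite) chart set \<Rightarrow> 'w measure \<Rightarrow> (real \<Rightarrow> 'w measure) \<Rightarrow>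
   (real \<Rightarrow> 'w \<Rightarrow> real) \<Rightarrow> ('q, 'n) lagrangian \<Rightarrow> ('q \<Rightarrow> real) \<Rightarrow> (real \<Rightarrow> real) \<Rightarrow> real set \<Rightarrow>
   (real \<Rightarrow> 'w \<Rightarrow> 'q) \<Rightarrow> (real \<Rightarrow> 'w \<Rightarrow> ('q, 'n) components) \<Rightarrow>
   (real \<Rightarrow> 'w \<Rightarrow> ('q, 'n) components) \<Rightarrow> bool" where
  "hamilton_pontryagin_eqs X A M F w L \<gamma> h T q v p \<longleftrightarrow>
     phase_process X A M F T q v p \<and>
     legendre_related A M L T q v p \<and>
     coordinate_sde A M F w T q
       (\<lambda>c s \<omega>. snd c (q s \<omega>))
       (\<lambda>c s \<omega>. v s \<omega> c)
       (\<lambda>c s \<omega>. 0) \<and>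
     coordinate_sde A M F w T q
       (\<lambda>c s \<omega>. p s \<omega> c)
       (\<lambda>c s \<omega>. \<chi> i. pd (\<lambda>x. local_lag A L c s x (v s \<omega> c)) (snd c (q s \<omega>)) i - p s \<omega> c $ i * h s)
       (\<lambda>c s \<omega>. \<chi> i. pd (\<gamma> \<circ> point c) (snd c (q s \<omega>)) i)"

text \<open>\<open>v\<close> is tied to \<open>p\<close> by \<open>p = \<partial>L/\<partial>v\<close>, and enters the equations themselves only by
  selecting the branch of the Hamiltonian.\<close>

definition hamilton_eqs ::
  "'q topology \<Rightarrow> ('q, 'n::finite) chart set \<Rightarrow> 'w measure \<Rightarrow> (real \<Rightarrow> 'w measure) \<Rightarrow>
   (real \<Rightarrow> 'w \<Rightarrow> real) \<Rightarrow> ('q, 'n) lagrangian \<Rightarrow> ('q \<Rightarrow> real) \<Rightarrow> (real \<Rightarrow> real) \<Rightarrow> real set \<Rightarrow>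
   (real \<Rightarrow> 'w \<Rightarrow> 'q) \<Rightarrow> (real \<Rightarrow> 'w \<Rightarrow> ('q, 'n) components) \<Rightarrow>
   (real \<Rightarrow> 'w \<Rightarrow> ('q, 'n) components) \<Rightarrow> bool" where
  "hamilton_eqs X A M F w L \<gamma> h T q v p \<longleftrightarrow>
     (let H = (\<lambda>c s \<omega>. hamiltonian (local_lag A L c) (snd c ` fst c) s (snd c (q s \<omega>)) (v s \<omega> c))
      in
        phase_process X A M F T q v p \<and>
        legendre_related A M L T q v p \<and>
        coordinate_sde A M F w T q
          (\<lambda>c s \<omega>. snd c (q s \<omega>))
          (\<lambda>c s \<omega>. \<chi> i. pd (\<lambda>y. H c s \<omega> s (snd c (q s \<omega>)) y) (p s \<omega> c) i)
          (\<lambda>c s \<omega>. 0) \<and>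
        coordinate_sde A M F w T q
          (\<lambda>c s \<omega>. p s \<omega> c)
          (\<lambda>c s \<omega>. \<chi> i. - pd (\<lambda>x. H c s \<omega> s x (p s \<omega> c)) (snd c (q s \<omega>)) i - p s \<omega> c $ i * h s)
          (\<lambda>c s \<omega>. \<chi> i. pd (\<gamma> \<circ> point c) (snd c (q s \<omega>)) i))"

end

theory Submission
  imports Defs
begin

text \<open>By the chain rule, \<open>dH = v\<^sup>i dp\<^sub>i + p\<^sub>i dv\<^sup>i - dL\<close>; on the graph \<open>p = \<partial>L/\<partial>v\<close> the \<open>dv\<close>-terms
  cancel, so that \<open>\<partial>H/\<partial>p\<^sub>i = v\<^sup>i\<close> and \<open>\<partial>H/\<partial>q\<^sup>i = -\<partial>L/\<partial>q\<^sup>i\<close> along any process satisfying the Legendre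
  relation. The inverse function theorem, applied to \<open>(s, x, y) \<mapsto> (s, x, \<partial>L/\<partial>v)\<close>, provides the
  differentiable local solution \<open>v(s, q, p)\<close> which this computation needs. The two systems hence have
  the same coefficients at all times at which the base process is in the chart domain, and stochastic
  integrals over stochastic intervals only see these coefficients.\<close>

section \<open>Partial derivatives\<close>

text \<open>Chain rule along the coordinate line. It connects the \<open>deriv\<close>-based
  \<open>pd\<close> with Frechet derivatives that are known to exist.\<close>

lemma pd_eq_has_derivative:
  assumes "(f has_derivative f') (at x)"
  shows "pd f x i = f' (axis i 1)"
proof -
  have lin: "linear f'"
    using assms has_derivative_linear by blast
  have "((\<lambda>e. f (x + e *\<^sub>R axis i 1)) has_derivative (\<lambda>e. f' (e *\<^sub>R axis i 1))) (at 0)"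
    by (rule has_derivative_compose[where g=f]) (use assms in \<open>auto intro!: derivative_eq_intros\<close>)
  then have "((\<lambda>e. f (x + e *\<^sub>R axis i 1)) has_field_derivative f' (axis i 1)) (at 0)"
    by (simp add: has_field_derivative_def linear_cmul[OF lin] mult.commute[of "f' _"] mult_commute_abs)
  then show ?thesis
    by (simp add: pd_def DERIV_imp_deriv)
qed

lemma pd_slice_fst:
  assumes "((\<lambda>(s, x, y). l s x y) has_derivative f') (at (s, x, y))"
  shows "pd (\<lambda>x. l s x y) x i = f' (0, axis i 1, 0)"
proof -
  have "((\<lambda>x. (s, x, y)) has_derivative (\<lambda>h. (0, h, 0))) (at x)"
    by (auto intro!: derivative_eq_intros)
  from has_derivative_compose[OF this assms] show ?thesis
    by (intro pd_eq_has_derivative) simp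
qed

lemma pd_slice_snd:
  assumes "((\<lambda>(s, x, y). l s x y) has_derivative f') (at (s, x, y))"
  shows "pd (l s x) y i = f' (0, 0, axis i 1)"
proof -
  have "((\<lambda>y. (s, x, y)) has_derivative (\<lambda>h. (0, 0, h))) (at y)"
    by (auto intro!: derivative_eq_intros)
  from has_derivative_compose[OF this assms] show ?thesis
    by (intro pd_eq_has_derivative) simp
qed

lemma Ck_on_Suc_has_derivative:
  assumes "Ck_on (Suc k) S f" "open S" "x \<in> S"
  shows "(f has_derivative frechet_derivative f (at x)) (at x)"
  using assms by (auto simp: differentiable_on_def at_within_open[of x S] frechet_derivative_works[symmetric]
      dest!: bspec)

section \<open>The Legendre map\<close>

text \<open>Time and position are carried along so that domain and codomain have equal dimension;
  inverting this map solves \<open>p = \<partial>L/\<partial>v\<close> for the velocity with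
  \<open>(s, x)\<close> as parameters.\<close>

definition legendre_map ::
  "'n::finite local_lagrangian \<Rightarrow> real \<times> (real^'n) \<times> (real^'n) \<Rightarrow> real \<times> (real^'n) \<times> (real^'n)" where
  "legendre_map l = (\<lambda>(s, x, y). (s, x, legendre l s x y))"

locale regular_local_lagrangian =
  fixes l :: "'n::finite local_lagrangian" and D :: "(real^'n) set"
  assumes open_D: "open D"
    and C2: "Ck_on 2 (UNIV \<times> D \<times> UNIV) (\<lambda>(s, x, y). l s x y)"
    and regular: "\<And>s x y. x \<in> D \<Longrightarrow> det (\<chi> i j. pd (\<lambda>z. pd (l s x) z j) y i) \<noteq> 0"
begin

abbreviation "S \<equiv> (UNIV :: real set) \<times> D \<times> (UNIV :: (real^'n) set)"

abbreviation "f \<equiv> \<lambda>(s, x, y). l s x y"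

abbreviation "f' z \<equiv> frechet_derivative f (at z)"

text \<open>The fibre derivative \<open>\<partial>L/\<partial>v\<^sup>i\<close> as a function of all
  variables jointly, in the form in which \<open>Ck_on\<close> exposes its regularity.\<close>

definition g :: "'n \<Rightarrow> real \<times> (real^'n) \<times> (real^'n) \<Rightarrow> real" where
  "g i z = f' z (0, 0, axis i 1)"

abbreviation "g' i z \<equiv> frechet_derivative (g i) (at z)"

abbreviation "\<Phi>' z h \<equiv> (fst h, fst (snd h), \<chi> i. g' i z h)"

lemma open_S: "open S"
  using open_D by (intro open_Times) auto

lemma f_has_derivative: "z \<in> S \<Longrightarrow> (f has_derivative f' z) (at z)"
  using C2 open_S by (auto simp: numeral_2_eq_2 intro!: Ck_on_Suc_has_derivative simp del: Ck_on.simps)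

text \<open>The direction in \<open>g\<close> is a basis vector of the product space, so the
  recursion of \<open>Ck_on\<close> lowers the order from 2 to 1.\<close>

lemma C1_g: "Ck_on 1 S (g i)"
proof -
  have "(0, 0, axis i 1) \<in> (Basis :: (real \<times> (real^'n) \<times> (real^'n)) set)"
    by (auto simp: Basis_prod_def axis_eq_axis)
  then show ?thesis
    using C2 by (auto simp: numeral_2_eq_2 g_def[abs_def])
qed

lemma g_has_derivative: "z \<in> S \<Longrightarrow> (g i has_derivative g' i z) (at z)"
  using C1_g open_S by (auto intro!: Ck_on_Suc_has_derivative[of 0] simp del: Ck_on.simps)

lemma legendre_eq: "x \<in> D \<Longrightarrow> legendre l s x y $ i = g i (s, x, y)"
  by (simp add: legendre_def g_def pd_slice_snd[OF f_has_derivative])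

lemma legendre_map_has_derivative:
  assumes "z \<in> S"
  shows "(legendre_map l has_derivative \<Phi>' z) (at z)"
\<comment> \<open>The momentum components are identified with \<open>g\<close> only over
  \<open>D\<close>, so the derivative is transferred on the open set \<open>S\<close>.\<close>
proof (rule has_derivative_transform_within_open[OF _ open_S assms])
  have "((\<lambda>z. \<chi> i. g i z) has_derivative (\<lambda>h. \<chi> i. g' i z h)) (at z)"
    using g_has_derivative[OF assms]
    by (subst has_derivative_componentwise_within) (auto simp: Basis_vec_def inner_axis)
  then show "((\<lambda>z. (fst z, fst (snd z), \<chi> i. g i z)) has_derivative \<Phi>' z) (at z)"
    by (auto intro!: derivative_eq_intros)
  show "(fst z, fst (snd z), \<chi> i. g i z) = legendre_map l z" if "z \<in> S" for z
    using that by (auto simp: legendre_map_def vec_eq_iff legendre_eq)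
qed

text \<open>The inverse function theorem takes derivatives as bounded linear operators;
  \<open>Blinfun\<close> is faithful on \<open>S\<close>, where \<open>\<Phi>'\<close> is bounded
  linear.\<close>

lemma apply_Blinfun: "z \<in> S \<Longrightarrow> blinfun_apply (Blinfun (\<Phi>' z)) = \<Phi>' z"
  using legendre_map_has_derivative bounded_linear_Blinfun_apply has_derivative_bounded_linear by blast

text \<open>In finite dimension, continuity in operator norm may be tested on basis vectors, where
  it is the continuity of the second derivatives.\<close>

lemma legendre_map_continuous_derivative:
  "continuous_on S (\<lambda>z. Blinfun (\<Phi>' z))"
proof -
  have "continuous_on S (\<lambda>z. blinfun_apply (Blinfun (\<Phi>' z)) b)" if "b \<in> Basis" for b
  proof -
    have "continuous_on S (\<lambda>z. g' i z b)" for i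
      using C1_g[of i] that by simp
    then have "continuous_on S (\<lambda>z. \<Phi>' z b)"
      by (intro continuous_intros)
    then show ?thesis
      by (simp add: apply_Blinfun cong: continuous_on_cong)
  qed
  then show ?thesis
    by (rule continuous_on_blinfun_componentwise)
qed

text \<open>The derivative is block triangular with identity blocks for time and position and the
  fibre Hessian in the last block, hence injective.\<close>

lemma legendre_map_derivative_inverse:
  assumes "z \<in> S"
  obtains \<Psi> where "bounded_linear \<Psi>" "\<Psi> \<circ> \<Phi>' z = id"
proof -
  obtain s x y where z: "z = (s, x, y)" "x \<in> D"
    using assms by auto
  have lin: "linear (\<Phi>' z)"
    using legendre_map_has_derivative[OF assms] has_derivative_linear by blast
  define B where "B = (\<chi> i j. pd (\<lambda>z. pd (l s x) z j) y i)"
  have B: "B $ i $ j = g' j z (0, 0, axis i 1)" for i j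
  proof -
    have "(\<lambda>y. pd (l s x) y j) = (\<lambda>y. g j (s, x, y))"
      using z legendre_eq by (auto simp: legendre_def)
    then show ?thesis
      using pd_slice_snd[of "\<lambda>s x y. g j (s, x, y)"] g_has_derivative[OF assms, of j]
      by (simp add: B_def z)
  qed
  have "h = 0" if h0: "\<Phi>' z h = 0" for h
  proof -
    obtain k where h: "h = (0, 0, k)"
      using h0 by (cases h) (auto simp: zero_prod_def)
    \<comment> \<open>The row index of \<open>B\<close> is the direction of differentiation and the
      column index the momentum component, so the transpose acts on \<open>k\<close>.\<close>
    have "(transpose B *v k) $ j = 0" for j
    proof -
      have linj: "linear (g' j z)"
        using g_has_derivative[OF assms] has_derivative_linear by blast
      have "h = (\<Sum>i\<in>UNIV. k $ i *\<^sub>R (0, 0, axis i 1))"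
        by (simp add: h prod_eq_iff fst_sum snd_sum basis_expansion scalar_mult_eq_scaleR[symmetric])
      then have "g' j z h = (\<Sum>i\<in>UNIV. k $ i * B $ i $ j)"
        by (simp only: linear_sum[OF linj] linear_cmul[OF linj] B) simp
      moreover have "g' j z h = 0"
        using h0 by (simp add: zero_prod_def vec_eq_iff)
      ultimately show ?thesis
        by (simp add: matrix_vector_mult_def transpose_def mult.commute)
    qed
    moreover have "invertible (transpose B)"
      using regular[OF z(2)] by (simp add: invertible_det_nz det_transpose B_def)
    ultimately have "k = 0"
      by (metis (no_types) invertible_left_inverse matrix_left_invertible_ker vec_eq_iff zero_index)
    then show ?thesis
      by (simp add: h zero_prod_def)
  qed
  then have "inj (\<Phi>' z)"
    using linear_injective_0[OF lin] by blast
  then obtain \<Psi> where "linear \<Psi>" "\<Psi> \<circ> \<Phi>' z = id"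
    using linear_injective_left_inverse[OF lin] by blast
  then show thesis
    using that linear_conv_bounded_linear by blast
qed

section \<open>Velocity branches and the derivatives of the Hamiltonian\<close>

lemma velocity_branch_exists:
  assumes "x0 \<in> D"
  shows "\<exists>V. velocity_branch l D s0 x0 y0 V"
proof -
  let ?z = "(s0, x0, y0)"
  have z: "?z \<in> S"
    using assms by simp
  obtain \<Psi> where \<Psi>: "bounded_linear \<Psi>" "\<Psi> \<circ> \<Phi>' ?z = id"
    using legendre_map_derivative_inverse[OF z] .
  have inverse: "Blinfun \<Psi> o\<^sub>L Blinfun (\<Phi>' ?z) = id_blinfun"
    using \<Psi>(1) pointfree_idE[OF \<Psi>(2)]
    by (intro blinfun_eqI) (simp add: apply_Blinfun[OF z] bounded_linear_Blinfun_apply)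
  have deriv: "(legendre_map l has_derivative blinfun_apply (Blinfun (\<Phi>' z))) (at z)" if "z \<in> S" for z
    unfolding apply_Blinfun[OF that] by (rule legendre_map_has_derivative[OF that])
  obtain U W G where UWG: "open U" "U \<subseteq> S" "?z \<in> U" "open W" "legendre_map l ?z \<in> W"
      "homeomorphism U W (legendre_map l) G"
    using inverse_function_theorem[OF open_S deriv legendre_map_continuous_derivative z inverse] .
  have G: "G (s, x, p) \<in> S \<and> legendre_map l (G (s, x, p)) = (s, x, p)" if "(s, x, p) \<in> W" for s x p
    using UWG that unfolding homeomorphism_def by blast
  \<comment> \<open>The inverse \<open>G\<close> preserves time and position because
    \<open>legendre_map\<close> does; its last component is the velocity.\<close>
  have branch: "velocity_branch l D s0 x0 y0 (\<lambda>z. snd (snd (G z)))"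
    unfolding velocity_branch_def
  proof (intro exI conjI)
    show "open W" "(s0, x0, legendre l s0 x0 y0) \<in> W"
      using UWG by (auto simp: legendre_map_def)
    show "continuous_on W (\<lambda>z. snd (snd (G z)))"
      using UWG by (auto simp: homeomorphism_def intro!: continuous_intros)
    have "G (legendre_map l ?z) = ?z"
      using UWG unfolding homeomorphism_def by blast
    then show "snd (snd (G (s0, x0, legendre l s0 x0 y0))) = y0"
      by (simp add: legendre_map_def)
    show "\<forall>(s, x, p)\<in>W. x \<in> D \<and> legendre l s x (snd (snd (G (s, x, p)))) = p"
      using G by (fastforce simp: legendre_map_def split: prod.splits)
  qed
  show ?thesis
    by (rule exI) (rule branch)
qed

text \<open>Stated for every branch, since \<open>hamiltonian\<close> picks one by choice. A branch
  is only assumed continuous, but a continuous right inverse of a map with invertible derivative is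
  differentiable.\<close>

lemma velocity_branch_has_derivative:
  assumes "velocity_branch l D s0 x0 y0 V"
  obtains V' where "(V has_derivative V') (at (s0, x0, legendre l s0 x0 y0))"
proof -
  let ?P = "(s0, x0, legendre l s0 x0 y0)"
  obtain W where W: "open W" "?P \<in> W" "continuous_on W V" "V ?P = y0"
      "\<And>s x p. (s, x, p) \<in> W \<Longrightarrow> x \<in> D \<and> legendre l s x (V (s, x, p)) = p"
    using assms unfolding velocity_branch_def by blast
  define G where "G z = (fst z, fst (snd z), V z)" for z
  have z: "(s0, x0, y0) \<in> S"
    using W by auto
  obtain \<Psi> where \<Psi>: "bounded_linear \<Psi>" "\<Psi> \<circ> \<Phi>' (s0, x0, y0) = id"
    using legendre_map_derivative_inverse[OF z] .
  have "(G has_derivative \<Psi>) (at ?P)"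
  proof (rule has_derivative_inverse_basic[OF _ \<Psi> _ W(1,2)])
    show "(legendre_map l has_derivative \<Phi>' (s0, x0, y0)) (at (G ?P))"
      using legendre_map_has_derivative[OF z] W(4) by (simp add: G_def)
    have "continuous (at ?P) V"
      using W(1-3) continuous_on_eq_continuous_at by blast
    then show "continuous (at ?P) G"
      unfolding G_def[abs_def] by (intro continuous_intros)
    show "legendre_map l (G z) = z" if "z \<in> W" for z
      using W(5) that by (cases z) (auto simp: G_def legendre_map_def)
  qed
  then have "((\<lambda>z. snd (snd (G z))) has_derivative (\<lambda>h. snd (snd (\<Psi> h)))) (at ?P)"
    by (auto intro!: derivative_eq_intros)
  then show thesis
    using that by (simp add: G_def)
qed

text \<open>Differentiating \<open>p \<bullet> V - L(s, x, V)\<close> yields \<open>V'\<close>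
  twice, through the product and through the Lagrangian. Both terms equal
  \<open>p0 \<bullet> V'\<close>, so the choice of branch leaves no trace.\<close>

lemma hamiltonian_has_derivative:
  assumes "x0 \<in> D"
  shows "((\<lambda>(s, x, p). hamiltonian l D s0 x0 y0 s x p) has_derivative
           (\<lambda>(a, k, m). m \<bullet> y0 - f' (s0, x0, y0) (a, k, 0))) (at (s0, x0, legendre l s0 x0 y0))"
proof -
  define p0 where "p0 = legendre l s0 x0 y0"
  \<comment> \<open>The same choice term as in \<open>hamiltonian\<close>, so that unfolding exposes
    \<open>V\<close>.\<close>
  define V where "V = (SOME V. velocity_branch l D s0 x0 y0 V)"
  have branch: "velocity_branch l D s0 x0 y0 V"
    unfolding V_def using velocity_branch_exists[OF assms] by (rule someI_ex)
  then obtain V' where V': "(V has_derivative V') (at (s0, x0, p0))"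
    using velocity_branch_has_derivative unfolding p0_def by blast
  have V0: "V (s0, x0, p0) = y0"
    using branch by (auto simp: velocity_branch_def p0_def)
  have z: "(s0, x0, y0) \<in> S"
    using assms by simp
  have lin: "linear (f' (s0, x0, y0))"
    using f_has_derivative[OF z] has_derivative_linear by blast
  have f'_fibre: "f' (s0, x0, y0) (0, 0, k) = p0 \<bullet> k" for k
  proof -
    have "(0, 0, k) = (\<Sum>i\<in>UNIV. k $ i *\<^sub>R (0 :: real, 0 :: real^'n, axis i (1 :: real)))"
      by (simp add: prod_eq_iff fst_sum snd_sum basis_expansion scalar_mult_eq_scaleR[symmetric])
    then have "f' (s0, x0, y0) (0, 0, k) = (\<Sum>i\<in>UNIV. k $ i * f' (s0, x0, y0) (0, 0, axis i 1))"
      by (simp only: linear_sum[OF lin] linear_cmul[OF lin]) simp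
    then show ?thesis
      using legendre_eq[OF assms] by (simp add: p0_def g_def inner_vec_def mult.commute)
  qed
  have H: "(\<lambda>(s, x, p). hamiltonian l D s0 x0 y0 s x p) =
      (\<lambda>z. snd (snd z) \<bullet> V z - f (fst z, fst (snd z), V z))"
    by (auto simp: hamiltonian_def V_def[symmetric] inner_vec_def Let_def)
  have "((\<lambda>z. (fst z, fst (snd z), V z)) has_derivative (\<lambda>h. (fst h, fst (snd h), V' h))) (at (s0, x0, p0))"
    by (auto intro!: derivative_eq_intros V')
  then have "((\<lambda>z. f (fst z, fst (snd z), V z)) has_derivative
      (\<lambda>h. f' (s0, x0, y0) (fst h, fst (snd h), V' h))) (at (s0, x0, p0))"
    by (rule has_derivative_compose) (use f_has_derivative[OF z] V0 in simp)
  then have "((\<lambda>z. snd (snd z) \<bullet> V z - f (fst z, fst (snd z), V z)) has_derivative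
      (\<lambda>h. (p0 \<bullet> V' h + snd (snd h) \<bullet> y0) - f' (s0, x0, y0) (fst h, fst (snd h), V' h))) (at (s0, x0, p0))"
    by (auto intro!: derivative_eq_intros V' simp: V0)
  moreover have "f' (s0, x0, y0) (a, k, V' h) = f' (s0, x0, y0) (a, k, 0) + p0 \<bullet> V' h" for a k h
    using linear_add[OF lin, of "(a, k, 0)" "(0, 0, V' h)"] by (simp add: f'_fibre)
  ultimately show ?thesis
    unfolding H p0_def by (simp add: case_prod_unfold)
qed

lemma pd_hamiltonian_momentum:
  assumes "x0 \<in> D"
  shows "pd (\<lambda>p. hamiltonian l D s0 x0 y0 s0 x0 p) (legendre l s0 x0 y0) i = y0 $ i"
proof -
  have "linear (f' (s0, x0, y0))"
    using f_has_derivative assms has_derivative_linear by blast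
  then have "f' (s0, x0, y0) (0, 0, 0) = 0"
    using linear_0 by (fastforce simp: zero_prod_def)
  then show ?thesis
    using pd_slice_snd[OF hamiltonian_has_derivative[OF assms]] by (simp add: inner_axis')
qed

text \<open>On the left the momentum is fixed and the velocity follows the branch as
  \<open>x\<close> varies; on the right the velocity is fixed.\<close>

lemma pd_hamiltonian_position:
  assumes "x0 \<in> D"
  shows "pd (\<lambda>x. hamiltonian l D s0 x0 y0 s0 x (legendre l s0 x0 y0)) x0 i
       = - pd (\<lambda>x. l s0 x y0) x0 i"
  using pd_slice_fst[OF hamiltonian_has_derivative[OF assms], where i=i]
    pd_slice_fst[OF f_has_derivative, where i=i and s=s0 and x=x0 and y=y0] assms
  by simp

end

section \<open>Dependence of the stochastic equations on their coefficients\<close>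

lemma progressive_cong:
  assumes "filtration (space M) F" "\<And>s \<omega>. \<omega> \<in> space M \<Longrightarrow> \<phi> s \<omega> = \<psi> s \<omega>"
  shows "progressive F a b \<phi> \<longleftrightarrow> progressive F a b \<psi>"
proof -
  \<comment> \<open>Progressive measurability refers to \<open>F u\<close>, while the integrands are
    compared on \<open>space M\<close>.\<close>
  have "space (F u) = space M" for u
    using assms(1) by (rule filtration.space_F)
  then show ?thesis
    unfolding progressive_def using assms(2)
    by (intro ball_cong refl measurable_cong) (auto simp: space_pair_measure)
qed

lemma ito_increment_cong_drift:
  assumes "filtration (space M) F" "\<And>s \<omega>. \<omega> \<in> space M \<Longrightarrow> \<mu> s \<omega> = \<nu> s \<omega>"
  shows "ito_increment M F w a b \<mu> \<sigma> Z \<longleftrightarrow> ito_increment M F w a b \<nu> \<sigma> Z"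
proof -
  have "(AE \<omega> in M. set_integrable lborel {a..b} (\<lambda>s. \<mu> s \<omega>)) \<longleftrightarrow>
        (AE \<omega> in M. set_integrable lborel {a..b} (\<lambda>s. \<nu> s \<omega>))"
    by (rule AE_cong) (simp add: assms(2))
  moreover have "(AE \<omega> in M. Z \<omega> = (LINT s:{a..b}|lborel. \<mu> s \<omega>) + I \<omega>) \<longleftrightarrow>
        (AE \<omega> in M. Z \<omega> = (LINT s:{a..b}|lborel. \<nu> s \<omega>) + I \<omega>)" for I
    by (rule AE_cong) (simp add: assms(2))
  ultimately show ?thesis
    using progressive_cong[OF assms] by (simp add: ito_increment_def)
qed

text \<open>The drifts need to agree only while \<open>q\<close> is in the chart domain: the
  indicator between the stopping times removes everything else.\<close>

lemma coordinate_sde_cong_drift: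
  assumes filt: "filtration (space M) F" and T: "is_interval T"
    and eq: "\<And>c s \<omega>. c \<in> A \<Longrightarrow> s \<in> T \<Longrightarrow> \<omega> \<in> space M \<Longrightarrow> q s \<omega> \<in> fst c \<Longrightarrow> \<mu> c s \<omega> = \<nu> c s \<omega>"
  shows "coordinate_sde A M F w T q Y \<mu> \<sigma> \<longleftrightarrow> coordinate_sde A M F w T q Y \<nu> \<sigma>"
  unfolding coordinate_sde_def
proof (intro ball_cong refl all_cong1 imp_cong)
  fix c a b \<tau>1 \<tau>2 i
  assume c: "c \<in> A" and ab: "a \<in> T" "b \<in> T"
    and \<tau>: "stopping_time F \<tau>1 \<and> stopping_time F \<tau>2 \<and>
        (\<forall>\<omega>\<in>space M. a \<le> \<tau>1 \<omega> \<and> \<tau>1 \<omega> \<le> \<tau>2 \<omega> \<and> \<tau>2 \<omega> \<le> b \<and>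
           (\<tau>1 \<omega> < \<tau>2 \<omega> \<longrightarrow> (\<forall>s\<in>{\<tau>1 \<omega>..\<tau>2 \<omega>}. q s \<omega> \<in> fst c)))"
  have "indicator {\<tau>1 \<omega>..<\<tau>2 \<omega>} s * \<mu> c s \<omega> $ i = indicator {\<tau>1 \<omega>..<\<tau>2 \<omega>} s * \<nu> c s \<omega> $ i"
    if \<omega>: "\<omega> \<in> space M" for s \<omega>
  proof (cases "s \<in> {\<tau>1 \<omega>..<\<tau>2 \<omega>}")
    case True
    then have s: "a \<le> s" "s \<le> b" "q s \<omega> \<in> fst c"
      using \<tau> \<omega> by force+
    \<comment> \<open>Stopping times take arbitrary values between \<open>a\<close> and
      \<open>b\<close>; convexity of \<open>T\<close> covers them.\<close>
    then have "s \<in> T"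
      using T ab by (meson is_interval_1)
    then show ?thesis
      using eq[OF c _ \<omega>] s by simp
  qed simp
  then show "ito_increment M F w a b
        (\<lambda>s \<omega>. indicator {\<tau>1 \<omega>..<\<tau>2 \<omega>} s * \<mu> c s \<omega> $ i)
        (\<lambda>s \<omega>. indicator {\<tau>1 \<omega>..<\<tau>2 \<omega>} s * \<sigma> c s \<omega> $ i)
        (\<lambda>\<omega>. Y c (\<tau>2 \<omega>) \<omega> $ i - Y c (\<tau>1 \<omega>) \<omega> $ i) \<longleftrightarrow>
      ito_increment M F w a b
        (\<lambda>s \<omega>. indicator {\<tau>1 \<omega>..<\<tau>2 \<omega>} s * \<nu> c s \<omega> $ i)
        (\<lambda>s \<omega>. indicator {\<tau>1 \<omega>..<\<tau>2 \<omega>} s * \<sigma> c s \<omega> $ i)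
        (\<lambda>\<omega>. Y c (\<tau>2 \<omega>) \<omega> $ i - Y c (\<tau>1 \<omega>) \<omega> $ i)"
    by (rule ito_increment_cong_drift[OF filt])
qed

section \<open>Equivalence of the two systems\<close>

theorem proposition6:
  fixes X :: "'q topology" and A :: "('q, 'n::finite) chart set"
    and L :: "('q, 'n) lagrangian" and \<gamma> :: "'q \<Rightarrow> real"
    and \<alpha> :: "real \<Rightarrow> real" and \<rho> t :: real
    and M :: "'w measure" and F :: "real \<Rightarrow> 'w measure" and w :: "real \<Rightarrow> 'w \<Rightarrow> real"
    and T :: "real set"
    and q :: "real \<Rightarrow> 'w \<Rightarrow> 'q" and v p :: "real \<Rightarrow> 'w \<Rightarrow> ('q, 'n) components"
  assumes "smooth_manifold X A"
    and "C2_lagrangian A L" and "hyperregular A L"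
    and "C2_function A \<gamma>"
    and "\<alpha> C1_differentiable_on UNIV"
    and "wiener_process M F w"
    and "is_interval T" and "T \<subseteq> {0..}" and "t \<notin> T"
  shows "hamilton_pontryagin_eqs X A M F w L \<gamma> (\<lambda>s. h_frac \<alpha> \<rho> s t) T q v p \<longleftrightarrow>
         hamilton_eqs X A M F w L \<gamma> (\<lambda>s. h_frac \<alpha> \<rho> s t) T q v p"
proof (cases "legendre_related A M L T q v p")
  case True
  let ?l = "\<lambda>c. local_lag A L c"
  let ?D = "\<lambda>c. snd c ` fst c"
  have filt: "filtration (space M) F"
    using assms by (simp add: wiener_process_def)
  have local: "regular_local_lagrangian (?l c) (?D c)" if "c \<in> A" for c
    using assms(1-3) that
    by (auto simp: regular_local_lagrangian_def smooth_manifold_def C2_lagrangian_def hyperregular_def)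
  \<comment> \<open>The process momentum is the base point of the chosen branch, exactly where the
    derivatives of the Hamiltonian were computed.\<close>
  have p: "p s \<omega> c = legendre (?l c) s (snd c (q s \<omega>)) (v s \<omega> c)" and x: "snd c (q s \<omega>) \<in> ?D c"
    if "c \<in> A" "s \<in> T" "\<omega> \<in> space M" "q s \<omega> \<in> fst c" for c s \<omega>
    using True that by (auto simp: legendre_related_def legendre_def vec_eq_iff)
  note pd_momentum = regular_local_lagrangian.pd_hamiltonian_momentum[OF local x]
    and pd_position = regular_local_lagrangian.pd_hamiltonian_position[OF local x]
  let ?H = "\<lambda>c s \<omega>. hamiltonian (?l c) (?D c) s (snd c (q s \<omega>)) (v s \<omega> c)"
  let ?h = "\<lambda>s. h_frac \<alpha> \<rho> s t"
  have "coordinate_sde A M F w T q Y (\<lambda>c s \<omega>. v s \<omega> c) \<sigma> \<longleftrightarrow>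
      coordinate_sde A M F w T q Y
        (\<lambda>c s \<omega>. \<chi> i. pd (\<lambda>y. ?H c s \<omega> s (snd c (q s \<omega>)) y) (p s \<omega> c) i) \<sigma>" for Y \<sigma>
    by (rule coordinate_sde_cong_drift[OF filt assms(7)]) (simp add: vec_eq_iff p pd_momentum)
  \<comment> \<open>The damping term with \<open>h_frac\<close> is the same on both sides; only the
    position derivatives are exchanged.\<close>
  moreover have "coordinate_sde A M F w T q Y
        (\<lambda>c s \<omega>. \<chi> i. pd (\<lambda>x. ?l c s x (v s \<omega> c)) (snd c (q s \<omega>)) i - p s \<omega> c $ i * ?h s) \<sigma> \<longleftrightarrow>
      coordinate_sde A M F w T q Y
        (\<lambda>c s \<omega>. \<chi> i. - pd (\<lambda>x. ?H c s \<omega> s x (p s \<omega> c)) (snd c (q s \<omega>)) i - p s \<omega> c $ i * ?h s) \<sigma>" for Y \<sigma>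
    by (rule coordinate_sde_cong_drift[OF filt assms(7)]) (simp add: vec_eq_iff p pd_position)
  ultimately show ?thesis
    by (simp add: hamilton_pontryagin_eqs_def hamilton_eqs_def)
next
  \<comment> \<open>Both systems contain the Legendre relation, so here both are false.\<close>
  case False
  then show ?thesis
    by (simp add: hamilton_pontryagin_eqs_def hamilton_eqs_def)
qed

end
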